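(* For every positive integer $n$, the number of partitions of $n$ into odd parts is equal to the number of partitions $\lambda_1+\cdots+\lambda_s$ of $n$ (with $\lambda_1\ge\cdots\ge\lambda_s\ge1$) such that, for all $1\le i\le s-1$, $$\begin{aligned}\lambda_i-\lambda_{i+1}=0&\Rightarrow \lambda_i+\lambda_{i+1}\equiv\pm4 \pmod{16},\\ \lambda_i-\lambda_{i+1}=1&\Rightarrow \lambda_i+\lambda_{i+1}\equiv\pm3 \pmod{16},\\ \lambda_i-\lambda_{i+1}=2&\Rightarrow \lambda_i+\lambda_{i+1}\equiv\pm2,\pm6 \pmod{16},\\ \lambda_i-\lambda_{i+1}=3&\Rightarrow \lambda_i+\lambda_{i+1}\equiv\pm1,\pm5,\pm7 \pmod{16}.\end{aligned}$$
   Context: A partition of a positive integer $n$ is a non-increasing sequence of positive integers (the parts), possibly repeated, with sum $n$. *)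

theory Defs
  imports "HOL-Number_Theory.Number_Theory"
begin

definition partitions :: "nat \<Rightarrow> nat list set" where
  "partitions n = {ps. sorted_wrt (\<ge>) ps \<and> (\<forall>p\<in>set ps. 1 \<le> p) \<and> sum_list ps = n}"

definition odd_partitions :: "nat \<Rightarrow> nat list set" where
  "odd_partitions n = {ps \<in> partitions n. \<forall>p\<in>set ps. odd p}"

definition cong_pm :: "int \<Rightarrow> int \<Rightarrow> int \<Rightarrow> bool" where
  "cong_pm a b m \<longleftrightarrow> [a = b] (mod m) \<or> [a = - b] (mod m)"

text \<open>Condition on two consecutive parts \<open>a \<ge> b\<close>; it is taken over the integers so that
  the difference does not truncate.\<close>

definition diff_cond :: "int \<Rightarrow> int \<Rightarrow> bool" where
  "diff_cond a b \<longleftrightarrow>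
     (a - b = 0 \<longrightarrow> cong_pm (a + b) 4 16) \<and>
     (a - b = 1 \<longrightarrow> cong_pm (a + b) 3 16) \<and>
     (a - b = 2 \<longrightarrow> cong_pm (a + b) 2 16 \<or> cong_pm (a + b) 6 16) \<and>
     (a - b = 3 \<longrightarrow> cong_pm (a + b) 1 16 \<or> cong_pm (a + b) 5 16 \<or> cong_pm (a + b) 7 16)"

text \<open>List positions start at 0: the pair \<open>i\<close>, \<open>Suc i\<close> consists of the parts usually
  numbered \<open>i + 1\<close> and \<open>i + 2\<close>.\<close>

definition diff_partitions :: "nat \<Rightarrow> nat list set" where
  "diff_partitions n =
     {ps \<in> partitions n. \<forall>i. Suc i < length ps \<longrightarrow> diff_cond (int (ps ! i)) (int (ps ! Suc i))}"

text \<open>Since \<open>card\<close> is 0 on infinite sets, finiteness is recorded here.\<close>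

lemma finite_partitions: "finite (partitions n)"
proof (rule finite_subset)
  have len: "length ps \<le> sum_list ps" if "\<forall>p\<in>set ps. 1 \<le> p" for ps :: "nat list"
    using that by (induction ps) auto
  show "partitions n \<subseteq> {ps. set ps \<subseteq> {..n} \<and> length ps \<le> n}"
    using len by (auto simp: partitions_def member_le_sum_list)
  show "finite {ps. set ps \<subseteq> {..n} \<and> length ps \<le> n}"
    by (rule finite_lists_length_le) simp
qed

lemma finite_odd_partitions: "finite (odd_partitions n)"
  by (simp add: odd_partitions_def finite_partitions)

lemma finite_diff_partitions: "finite (diff_partitions n)"
  by (simp add: diff_partitions_def finite_partitions)

end

theory Submission
  imports Defs "HOL-Computational_Algebra.Formal_Power_Series"
begin

text \<open>
  The proof refines the identity by a second statistic. An odd part counts once and an even part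
  counts twice, as if it were the sum of two odd parts (such as \<open>2 = 1 + 1\<close>, \<open>4 = 3 + 1\<close>,
  \<open>6 = 3 + 3\<close>). Let \<open>F(x, q)\<close> be the sum of \<open>x\<^sup>c q\<^sup>n\<close> over all
  partitions that satisfy the difference conditions, with \<open>n\<close> the sum of the parts and \<open>c\<close>
  this count. The claim is that \<open>F(x, q)\<close> is the product of \<open>1 / (1 - x q\<^sup>m)\<close> over
  the odd \<open>m\<close>, and it follows from the functional equation
  \<open>(1 - x q) F(x, q) = F(x q\<^sup>2, q)\<close>, because repeated substitution pushes all
  nonempty partitions to arbitrarily high order.

  Only \<open>x = q\<^bsup>2 j\<^esup>\<close> is needed, so univariate power series suffice: the parameter
  \<open>j\<close> gives an odd part \<open>a\<close> the weight \<open>a + 2 j\<close> and an even part the weight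
  \<open>a + 4 j\<close>, and \<open>y j\<close> stands for \<open>x q = q\<^bsup>2 j + 1\<^esup>\<close>.

  The functional equation comes from an exact finite form. Write \<open>T j n\<close> for the generating
  function of the partitions with largest part at most \<open>n\<close>. Then for even \<open>n \<ge> 2\<close>
  one has \<open>(1 - y j) T j n = T (j + 1) (n - 3)\<close>, where the right-hand side is 1 for
  \<open>n = 2\<close>.
  The difference conditions depend on residues modulo 8 only, so the series \<open>W j n\<close> of the
  partitions with largest part exactly \<open>n\<close> satisfies one of eight linear recurrences
  (lemma \<open>W_rec\<close>). Comparing the recurrences for \<open>T j n\<close> and for
  \<open>T (j + 1) (n - 3)\<close> in each of the four even residue classes gives the finite form by
  induction (lemma \<open>T_functional_equation\<close>).

  Reading off coefficients yields a recurrence in \<open>j\<close> and \<open>N\<close> (lemma \<open>card_words_rec\<close>)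
  which is the one that partitions of \<open>N\<close> into odd parts \<open>\<ge> 2 j + 1\<close> satisfy
  upon removal of a smallest part equal to \<open>2 j + 1\<close> (lemma \<open>card_odd_words_rec\<close>).
\<close>

section \<open>Words with restricted neighbours\<close>

definition admits :: "nat \<Rightarrow> nat \<Rightarrow> bool" where
  "admits a b \<longleftrightarrow> b \<le> a \<and> diff_cond (int a) (int b)"

definition admissible :: "nat list \<Rightarrow> bool" where
  "admissible ps \<longleftrightarrow> 0 \<notin> set ps \<and> successively admits ps"

lemma admissible_Nil [simp]: "admissible []"
  by (simp add: admissible_def)

lemma admissible_Cons:
  "admissible (a # ps) \<longleftrightarrow> 0 < a \<and> admissible ps \<and> (ps = [] \<or> admits a (hd ps))"
  by (auto simp: admissible_def successively_Cons)

lemma diff_partitions_eq_admissible: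
  "diff_partitions n = {ps. admissible ps \<and> sum_list ps = n}"
proof -
  have "sorted_wrt (\<ge>) ps \<and> (\<forall>i. Suc i < length ps \<longrightarrow> diff_cond (int (ps ! i)) (int (ps ! Suc i)))
      \<longleftrightarrow> successively admits ps" for ps :: "nat list"
  proof -
    have "sorted_wrt (\<ge>) ps \<longleftrightarrow> successively (\<ge>) ps"
      by (rule successively_conv_sorted_wrt[symmetric]) (auto intro: transpI)
    then show ?thesis
      by (auto simp: successively_conv_nth admits_def)
  qed
  moreover have "(\<forall>p\<in>set ps. 1 \<le> p) \<longleftrightarrow> 0 \<notin> set ps" for ps :: "nat list"
    by (metis One_nat_def Suc_leI gr_zeroI not_one_le_zero)
  ultimately show ?thesis
    by (auto simp: diff_partitions_def partitions_def admissible_def)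
qed

text \<open>A sign-symmetric congruence between sums of naturals names two complementary residues; in
  this form everything can be decided from residues of naturals.\<close>

lemma cong_pm_nat:
  assumes "0 < r" "0 < s" "r + s = 16"
  shows "cong_pm (int a + int b) (int r) 16 \<longleftrightarrow> (a + b) mod 16 = r \<or> (a + b) mod 16 = s"
proof -
  have "int r mod 16 = int r"
    using assms by (intro mod_pos_pos_trivial) auto
  moreover from this have "(- int r) mod 16 = int s"
    using assms by (simp add: zmod_zminus1_eq_if)
  moreover have "(int a + int b) mod 16 = int ((a + b) mod 16)"
    by (simp add: zmod_int)
  ultimately show ?thesis
    by (simp only: cong_pm_def cong_def of_nat_eq_iff)
qed

text \<open>When the difference is fixed, the sum modulo 16 is determined by the larger part modulo 8.\<close>

lemma admits_iff:
  "admits a b \<longleftrightarrow>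
     b + 4 \<le> a \<or>
     a = b \<and> (a mod 8 = 2 \<or> a mod 8 = 6) \<or>
     a = b + 1 \<and> (a mod 8 = 2 \<or> a mod 8 = 7) \<or>
     a = b + 2 \<and> even a \<or>
     a = b + 3 \<and> a mod 8 \<noteq> 0 \<and> a mod 8 \<noteq> 3"
proof -
  note cong = cong_pm_nat[of 1 15, simplified] cong_pm_nat[of 2 14, simplified]
    cong_pm_nat[of 3 13, simplified] cong_pm_nat[of 4 12, simplified]
    cong_pm_nat[of 5 11, simplified] cong_pm_nat[of 6 10, simplified]
    cong_pm_nat[of 7 9, simplified]
  have sum: "(b + d + b) mod 16 = (2 * (b mod 8) + d) mod 16" for d
    using mult_mod_right[of 2 b 8]
    by (metis add.commute add.left_commute mod_add_left_eq mult_2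
        numeral_times_numeral semiring_norm(12,13))
  have shift: "(b + d) mod 8 = (b mod 8 + d) mod 8" for d
    by (simp add: mod_add_left_eq)
  have even: "even b \<longleftrightarrow> even (b mod 8)"
    by presburger
  have "b mod 8 < 8" by simp
  then consider "b mod 8 = 0" | "b mod 8 = 1" | "b mod 8 = 2" | "b mod 8 = 3"
    | "b mod 8 = 4" | "b mod 8 = 5" | "b mod 8 = 6" | "b mod 8 = 7"
    by linarith
  note residues = this
  consider "a < b" | "b + 4 \<le> a" | "a = b + 0" | "a = b + 1" | "a = b + 2" | "a = b + 3"
    by linarith
  then show ?thesis
  proof cases
    case 3
    then show ?thesis
      unfolding admits_def diff_cond_def cong 3 sum shift
      by (cases rule: residues) simp_all
  next
    case 4
    show ?thesis
      unfolding admits_def diff_cond_def cong 4 sum shift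
      by (cases rule: residues) simp_all
  next
    case 5
    show ?thesis
      unfolding admits_def diff_cond_def cong 5 sum shift
      by (cases rule: residues) (simp_all add: even)
  next
    case 6
    show ?thesis
      unfolding admits_def diff_cond_def cong 6 sum shift
      by (cases rule: residues) simp_all
  qed (auto simp: admits_def diff_cond_def)
qed

lemma even_mod_8_iff: "even a \<longleftrightarrow> even (a mod 8)" for a :: nat
  by presburger

text \<open>The possible successors of a part always form an initial interval, up to one extra element
  that skips over a single forbidden value. This is what makes the generating functions below
  satisfy recurrences of bounded length. Truncated subtraction is harmless: an interval whose upper
  end would be negative is empty.\<close>

lemma admits_classes:
  "a mod 8 = 1 \<Longrightarrow> {b. 0 < b \<and> admits a b} = {0<..a - 3}"
  "a mod 8 = 2 \<Longrightarrow> {b. 0 < b \<and> admits a b} = {0<..a}"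
  "a mod 8 = 3 \<Longrightarrow> {b. 0 < b \<and> admits a b} = {0<..a - 4}"
  "a mod 8 = 4 \<Longrightarrow> {b. 0 < b \<and> admits a b} = {0<..a - 2}"
  "a mod 8 = 5 \<Longrightarrow> {b. 0 < b \<and> admits a b} = {0<..a - 3}"
  "a mod 8 = 6 \<Longrightarrow> {b. 0 < b \<and> admits a b} = insert a {0<..a - 2}"
  "a mod 8 = 7 \<Longrightarrow> {b. 0 < b \<and> admits a b} = insert (a - 1) {0<..a - 3}"
  "a mod 8 = 0 \<Longrightarrow> 0 < a \<Longrightarrow> {b. 0 < b \<and> admits a b} = insert (a - 2) {0<..a - 4}"
proof -
  have "a = 0 \<or> 8 \<le> a" if "a mod 8 = 0"
    using that by presburger
  moreover have "6 \<le> a" if "a mod 8 = 6"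
    using that by presburger
  moreover have "7 \<le> a" if "a mod 8 = 7"
    using that by presburger
  ultimately show
    "a mod 8 = 1 \<Longrightarrow> {b. 0 < b \<and> admits a b} = {0<..a - 3}"
    "a mod 8 = 2 \<Longrightarrow> {b. 0 < b \<and> admits a b} = {0<..a}"
    "a mod 8 = 3 \<Longrightarrow> {b. 0 < b \<and> admits a b} = {0<..a - 4}"
    "a mod 8 = 4 \<Longrightarrow> {b. 0 < b \<and> admits a b} = {0<..a - 2}"
    "a mod 8 = 5 \<Longrightarrow> {b. 0 < b \<and> admits a b} = {0<..a - 3}"
    "a mod 8 = 6 \<Longrightarrow> {b. 0 < b \<and> admits a b} = insert a {0<..a - 2}"
    "a mod 8 = 7 \<Longrightarrow> {b. 0 < b \<and> admits a b} = insert (a - 1) {0<..a - 3}"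
    "a mod 8 = 0 \<Longrightarrow> 0 < a \<Longrightarrow> {b. 0 < b \<and> admits a b} = insert (a - 2) {0<..a - 4}"
    by (auto simp: admits_iff even_mod_8_iff[of a])
qed

section \<open>Generating functions by largest part\<close>

text \<open>An even part moves twice as fast with \<open>j\<close> as an odd one, since it stands for two odd
  parts. Passing from \<open>j\<close> to \<open>j + 1\<close> is the substitution of \<open>x q\<^sup>2\<close> for
  \<open>x\<close>.\<close>

definition wt :: "nat \<Rightarrow> nat \<Rightarrow> nat" where
  "wt j a = (if even a then a + 4 * j else a + 2 * j)"

definition weight :: "nat \<Rightarrow> nat list \<Rightarrow> nat" where
  "weight j ps = (\<Sum>p\<leftarrow>ps. wt j p)"

lemma weight_simps [simp]: "weight j [] = 0" "weight j (a # ps) = wt j a + weight j ps"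
  by (simp_all add: weight_def)

lemma weight_0: "weight 0 ps = sum_list ps"
  by (induction ps) (auto simp: wt_def)

lemma sum_list_le_weight: "sum_list ps \<le> weight j ps"
  by (induction ps) (auto simp: wt_def)

definition words :: "nat \<Rightarrow> nat set \<Rightarrow> nat \<Rightarrow> nat list set" where
  "words j B N = {ps. admissible ps \<and> (ps = [] \<or> hd ps \<in> B) \<and> weight j ps = N}"

lemma finite_words: "finite (words j B N)"
proof (rule finite_subset)
  have len: "length ps \<le> sum_list ps" if "0 \<notin> set ps" for ps :: "nat list"
    using that by (induction ps) auto
  have "length ps \<le> N \<and> set ps \<subseteq> {..N}" if "ps \<in> words j B N" for ps
  proof -
    have "sum_list ps \<le> N" "0 \<notin> set ps"
      using that sum_list_le_weight[of ps j] by (auto simp: words_def admissible_def)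
    then show ?thesis
      using len[of ps] member_le_sum_list[of _ ps] by fastforce
  qed
  then show "words j B N \<subseteq> {ps. set ps \<subseteq> {..N} \<and> length ps \<le> N}"
    by blast
  show "finite {ps. set ps \<subseteq> {..N} \<and> length ps \<le> N}"
    by (rule finite_lists_length_le) simp
qed

text \<open>The generating function of the words whose first letter, if any, lies in \<open>B\<close>.\<close>

definition gf :: "nat \<Rightarrow> nat set \<Rightarrow> int fps" where
  "gf j B = Abs_fps (\<lambda>N. int (card (words j B N)))"

text \<open>\<open>T j n\<close> collects the words with largest part at most \<open>n\<close>, including the empty word,
  and \<open>W j a\<close> those with largest part \<open>a\<close>; the latter is written as first letter times
  remaining word. Letters 0 do not occur in admissible words, so that \<open>T j 0 = 1\<close>.\<close>

definition T :: "nat \<Rightarrow> nat \<Rightarrow> int fps" where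
  "T j n = gf j {0<..n}"

definition W :: "nat \<Rightarrow> nat \<Rightarrow> int fps" where
  "W j a = fps_X ^ wt j a * gf j {b. 0 < b \<and> admits a b}"

text \<open>Splitting a word into its first letter and the rest justifies the formula that defines
  \<open>W\<close>.\<close>

lemma gf_insert:
  assumes "0 < a" "a \<notin> B"
  shows "gf j (insert a B) = gf j B + W j a"
proof (rule fps_ext)
  fix N
  let ?C = "{b. 0 < b \<and> admits a b}"
  let ?S = "if wt j a \<le> N then words j ?C (N - wt j a) else {}"
  have "words j (insert a B) N = words j B N \<union> (#) a ` ?S" (is "?L = ?R")
  proof (rule Set.set_eqI)
    fix ps
    show "ps \<in> ?L \<longleftrightarrow> ps \<in> ?R"
    proof (cases ps)
      case Nil
      then show ?thesis by (auto simp: words_def)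
    next
      case (Cons b qs)
      have "hd qs > 0" if "admissible qs" "qs \<noteq> []"
        using that by (cases qs) (auto simp: admissible_Cons)
      then show ?thesis
        using Cons assms by (auto simp: words_def admissible_Cons)
    qed
  qed
  moreover have "words j B N \<inter> (#) a ` ?S = {}"
  proof -
    have "words j B N \<subseteq> {ps. ps = [] \<or> hd ps \<in> B}"
      by (auto simp: words_def)
    moreover have "(#) a ` X \<inter> {ps. ps = [] \<or> hd ps \<in> B} = {}" for X
      using assms by auto
    ultimately show ?thesis by blast
  qed
  ultimately have "card (words j (insert a B) N) = card (words j B N) + card ?S"
    by (simp add: card_Un_disjoint finite_words card_image)
  then show "fps_nth (gf j (insert a B)) N = fps_nth (gf j B + W j a) N"
    by (simp add: gf_def W_def fps_X_power_mult_nth)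
qed

lemma T_step:
  assumes "n = Suc m"
  shows "T j n = T j m + W j n"
proof -
  have "{0<..n} = insert n {0<..m}" using assms by auto
  then show ?thesis using assms by (simp add: T_def gf_insert)
qed

lemma T_0: "T j 0 = 1"
proof -
  have "words j {0<..0} N = (if N = 0 then {[]} else {})" for N
    by (auto simp: words_def)
  then show ?thesis
    by (intro fps_ext) (auto simp: T_def gf_def)
qed

text \<open>The successor sets, translated into generating functions. In the classes 6, 7 and 0 the largest
  letter that may follow is separated from the interval by the forbidden value \<open>8 k + 5\<close>.\<close>

lemma W_rec:
  "W j (8 * k + 1) = fps_X ^ wt j (8 * k + 1) * T j (8 * k - 2)"
  "W j (8 * k + 2) = fps_X ^ wt j (8 * k + 2) * T j (8 * k + 2)"
  "W j (8 * k + 3) = fps_X ^ wt j (8 * k + 3) * T j (8 * k - 1)"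
  "W j (8 * k + 4) = fps_X ^ wt j (8 * k + 4) * T j (8 * k + 2)"
  "W j (8 * k + 5) = fps_X ^ wt j (8 * k + 5) * T j (8 * k + 2)"
  "W j (8 * k + 6) = fps_X ^ wt j (8 * k + 6) * (T j (8 * k + 4) + W j (8 * k + 6))"
  "W j (8 * k + 7) = fps_X ^ wt j (8 * k + 7) * (T j (8 * k + 4) + W j (8 * k + 6))"
  "W j (8 * k + 8) = fps_X ^ wt j (8 * k + 8) * (T j (8 * k + 4) + W j (8 * k + 6))"
proof -
  have *: "T j (8 * k + 4) + W j (8 * k + 6) = gf j (insert (8 * k + 6) {0<..8 * k + 4})"
    by (simp add: gf_insert T_def)
  have m: "(8 * k + r) mod 8 = r mod 8" for r
    by simp
  show
    "W j (8 * k + 1) = fps_X ^ wt j (8 * k + 1) * T j (8 * k - 2)"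
    "W j (8 * k + 2) = fps_X ^ wt j (8 * k + 2) * T j (8 * k + 2)"
    "W j (8 * k + 3) = fps_X ^ wt j (8 * k + 3) * T j (8 * k - 1)"
    "W j (8 * k + 4) = fps_X ^ wt j (8 * k + 4) * T j (8 * k + 2)"
    "W j (8 * k + 5) = fps_X ^ wt j (8 * k + 5) * T j (8 * k + 2)"
    using admits_classes[of "8 * k + 1"] admits_classes[of "8 * k + 2"] admits_classes[of "8 * k + 3"]
      admits_classes[of "8 * k + 4"] admits_classes[of "8 * k + 5"]
    unfolding m W_def T_def by simp_all
  show
    "W j (8 * k + 6) = fps_X ^ wt j (8 * k + 6) * (T j (8 * k + 4) + W j (8 * k + 6))"
    "W j (8 * k + 7) = fps_X ^ wt j (8 * k + 7) * (T j (8 * k + 4) + W j (8 * k + 6))"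
    "W j (8 * k + 8) = fps_X ^ wt j (8 * k + 8) * (T j (8 * k + 4) + W j (8 * k + 6))"
    using admits_classes[of "8 * k + 6"] admits_classes[of "8 * k + 7"] admits_classes[of "8 * k + 8"]
    unfolding m * unfolding W_def by (simp_all add: add.commute)
qed

section \<open>The functional equation\<close>

definition y :: "nat \<Rightarrow> int fps" where
  "y j = fps_X ^ (2 * j + 1)"

lemma y_square: "y j ^ 2 = fps_X ^ (2 * (2 * j + 1))"
  unfolding y_def by (metis mult.commute power_mult)

text \<open>In terms of \<open>y j\<close> the weights of \<open>2 i + 1\<close> and \<open>2 i + 2\<close> differ by one factor
  \<open>y j\<close> only, and the same holds for \<open>j + 1\<close> with the pair \<open>2 i + 3\<close>, \<open>2 i + 2\<close>. Many
  cancellations below rest on this.\<close>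

lemma X_power_wt:
  "odd a \<Longrightarrow> fps_X ^ wt j a = y j * fps_X ^ (a - 1)"
  "even a \<Longrightarrow> 0 < a \<Longrightarrow> fps_X ^ wt j a = y j ^ 2 * fps_X ^ (a - 2)"
proof -
  show "fps_X ^ wt j a = y j * fps_X ^ (a - 1)" if "odd a"
  proof -
    have "wt j a = (2 * j + 1) + (a - 1)"
      using odd_pos[OF that] that by (simp add: wt_def)
    then show ?thesis by (simp only: y_def power_add)
  qed
  show "fps_X ^ wt j a = y j ^ 2 * fps_X ^ (a - 2)" if "even a" "0 < a"
  proof -
    have "2 \<le> a" using that by presburger
    then have "wt j a = 2 * (2 * j + 1) + (a - 2)"
      using that by (simp add: wt_def)
    then show ?thesis by (simp only: y_square power_add)
  qed
qed

lemma X_power_wt_Suc: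
  "odd a \<Longrightarrow> fps_X ^ wt (Suc j) a = y j * fps_X ^ (a + 1)"
  "even a \<Longrightarrow> 0 < a \<Longrightarrow> fps_X ^ wt (Suc j) a = y j ^ 2 * fps_X ^ (a + 2)"
proof -
  have "wt (Suc j) a = wt j (a + 2)" if "odd a"
    using that by (simp add: wt_def)
  then show "odd a \<Longrightarrow> fps_X ^ wt (Suc j) a = y j * fps_X ^ (a + 1)"
    by (simp add: X_power_wt)
  have "wt (Suc j) a = wt j (a + 4)" if "even a"
    using that by (simp add: wt_def)
  then show "even a \<Longrightarrow> 0 < a \<Longrightarrow> fps_X ^ wt (Suc j) a = y j ^ 2 * fps_X ^ (a + 2)"
    by (simp add: X_power_wt del: power_Suc)
qed

lemma W_eq:
  "W j (8 * k + 1) = y j * fps_X ^ (8 * k) * T j (8 * k - 2)"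
  "W j (8 * k + 2) = y j ^ 2 * fps_X ^ (8 * k) * T j (8 * k + 2)"
  "W j (8 * k + 3) = y j * fps_X ^ (8 * k + 2) * T j (8 * k - 1)"
  "W j (8 * k + 4) = y j ^ 2 * fps_X ^ (8 * k + 2) * T j (8 * k + 2)"
  "W j (8 * k + 5) = y j * fps_X ^ (8 * k + 4) * T j (8 * k + 2)"
  "W j (8 * k + 6) = y j ^ 2 * fps_X ^ (8 * k + 4) * (T j (8 * k + 4) + W j (8 * k + 6))"
  "W j (8 * k + 7) = y j * fps_X ^ (8 * k + 6) * (T j (8 * k + 4) + W j (8 * k + 6))"
  "W j (8 * k + 8) = y j ^ 2 * fps_X ^ (8 * k + 6) * (T j (8 * k + 4) + W j (8 * k + 6))"
  apply (subst W_rec(1), simp add: X_power_wt)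
  apply (subst W_rec(2), simp add: X_power_wt)
  apply (subst W_rec(3), simp add: X_power_wt)
  apply (subst W_rec(4), simp add: X_power_wt)
  apply (subst W_rec(5), simp add: X_power_wt)
  apply (subst W_rec(6), simp add: X_power_wt)
  apply (subst W_rec(7), simp add: X_power_wt)
  apply (subst W_rec(8), simp add: X_power_wt)
  done

lemma W_Suc_eq:
  "W (Suc j) (8 * k + 1) = y j * fps_X ^ (8 * k + 2) * T (Suc j) (8 * k - 2)"
  "W (Suc j) (8 * k + 2) = y j ^ 2 * fps_X ^ (8 * k + 4) * T (Suc j) (8 * k + 2)"
  "W (Suc j) (8 * k + 3) = y j * fps_X ^ (8 * k + 4) * T (Suc j) (8 * k - 1)"
  "W (Suc j) (8 * k + 4) = y j ^ 2 * fps_X ^ (8 * k + 6) * T (Suc j) (8 * k + 2)"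
  "W (Suc j) (8 * k + 5) = y j * fps_X ^ (8 * k + 6) * T (Suc j) (8 * k + 2)"
  "W (Suc j) (8 * k + 6) = y j ^ 2 * fps_X ^ (8 * k + 8) * (T (Suc j) (8 * k + 4) + W (Suc j) (8 * k + 6))"
  "W (Suc j) (8 * k + 7) = y j * fps_X ^ (8 * k + 8) * (T (Suc j) (8 * k + 4) + W (Suc j) (8 * k + 6))"
  "W (Suc j) (8 * k + 8) = y j ^ 2 * fps_X ^ (8 * k + 10) * (T (Suc j) (8 * k + 4) + W (Suc j) (8 * k + 6))"
  apply (subst W_rec(1), simp add: X_power_wt_Suc)
  apply (subst W_rec(2), simp add: X_power_wt_Suc del: add_2_eq_Suc')
  apply (subst W_rec(3), simp add: X_power_wt_Suc)
  apply (subst W_rec(4), simp add: X_power_wt_Suc)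
  apply (subst W_rec(5), simp add: X_power_wt_Suc)
  apply (subst W_rec(6), simp add: X_power_wt_Suc)
  apply (subst W_rec(7), simp add: X_power_wt_Suc)
  apply (subst W_rec(8), simp add: X_power_wt_Suc)
  done

text \<open>Parts congruent to 2 or 6 modulo 8 may be repeated, and summing over the repetitions divides
  by such a factor. The proofs below clear these denominators and cancel them at the end.\<close>

lemma one_minus_y_square_nonzero: "1 - y j ^ 2 * fps_X ^ m \<noteq> 0"
proof
  assume "1 - y j ^ 2 * fps_X ^ m = 0"
  then have "fps_nth (1 - fps_X ^ (2 * (2 * j + 1) + m) :: int fps) 0 = 0"
    by (simp only: y_square power_add fps_zero_nth)
  then show False by (simp only: fps_sub_nth fps_X_power_nth) simp
qed

text \<open>The functional equation also holds for the words starting with \<open>8 k + 6\<close> or with at most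
  \<open>8 k + 4\<close>, the set of words that may follow \<open>8 k + 8\<close>. Both sides arise from the equation for
  \<open>8 k + 4\<close> by dividing by the same factor: on the left for repetitions of \<open>8 k + 6\<close>, on
  the right for repetitions of \<open>8 k + 2\<close>, whose weight with \<open>j + 1\<close> is the weight of
  \<open>8 k + 6\<close> with \<open>j\<close>.\<close>

lemma T_below_6:
  assumes "(1 - y j) * T j (8 * k + 4) = T (Suc j) (8 * k + 1)"
  shows "(1 - y j) * (T j (8 * k + 4) + W j (8 * k + 6)) = T (Suc j) (8 * k + 2)"
proof -
  let ?e = "1 - y j ^ 2 * fps_X ^ (8 * k + 4)"
  have "T (Suc j) (8 * k + 2) = T (Suc j) (8 * k + 1) + W (Suc j) (8 * k + 2)"
    using T_step[of "8 * k + 2" "8 * k + 1"] by simp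
  then have "?e * T (Suc j) (8 * k + 2) = T (Suc j) (8 * k + 1)"
    using W_Suc_eq(2)[of j k] by (simp add: algebra_simps)
  moreover have "?e * (T j (8 * k + 4) + W j (8 * k + 6)) = T j (8 * k + 4)"
    using W_eq(6)[of j k] by (simp add: algebra_simps)
  ultimately have "?e * ((1 - y j) * (T j (8 * k + 4) + W j (8 * k + 6))) = ?e * T (Suc j) (8 * k + 2)"
    using assms by (metis mult.left_commute)
  then show ?thesis
    using one_minus_y_square_nonzero[of j "8 * k + 4"] by (simp only: mult_cancel_left simp_thms)
qed

text \<open>The induction step, one lemma for each even residue class. In the classes 6 and 0 the summands
  of the two recurrences match one by one. For \<open>k = 0\<close> the term \<open>8 k - 1\<close> is truncated to 0,
  which gives the value 1 that the equation requires.\<close>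

lemma T_case_6:
  assumes "(1 - y j) * T j (8 * k + 2) = T (Suc j) (8 * k - 1)"
    and "(1 - y j) * T j (8 * k + 4) = T (Suc j) (8 * k + 1)"
  shows "(1 - y j) * T j (8 * k + 6) = T (Suc j) (8 * k + 3)"
proof -
  let ?z = "fps_X ^ (8 * k + 4) :: int fps"
  have "T j (8 * k + 6) = (T j (8 * k + 4) + W j (8 * k + 6)) + y j * ?z * T j (8 * k + 2)"
    using T_step[of "8 * k + 5" "8 * k + 4"] T_step[of "8 * k + 6" "8 * k + 5"] W_eq(5)[of j k] by simp
  then have "(1 - y j) * T j (8 * k + 6)
      = (1 - y j) * (T j (8 * k + 4) + W j (8 * k + 6)) + y j * ?z * ((1 - y j) * T j (8 * k + 2))"
    by (simp only: algebra_simps)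
  also have "\<dots> = T (Suc j) (8 * k + 2) + W (Suc j) (8 * k + 3)"
    unfolding T_below_6[OF assms(2)] assms(1) W_Suc_eq ..
  also have "\<dots> = T (Suc j) (8 * k + 3)"
    using T_step[of "8 * k + 3" "8 * k + 2"] by simp
  finally show ?thesis .
qed

lemma T_case_8:
  assumes "(1 - y j) * T j (8 * k + 4) = T (Suc j) (8 * k + 1)"
    and "(1 - y j) * T j (8 * k + 6) = T (Suc j) (8 * k + 3)"
  shows "(1 - y j) * T j (8 * k + 8) = T (Suc j) (8 * k + 5)"
proof -
  let ?z = "fps_X ^ (8 * k + 6) :: int fps"
  have "T j (8 * k + 8) = T j (8 * k + 6) + (y j + y j ^ 2) * ?z * (T j (8 * k + 4) + W j (8 * k + 6))"
    using T_step[of "8 * k + 7" "8 * k + 6" j] T_step[of "8 * k + 8" "8 * k + 7" j] W_eq(7,8)[of j k]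
    by (simp add: algebra_simps)
  then have "(1 - y j) * T j (8 * k + 8) = (1 - y j) * T j (8 * k + 6)
      + (y j + y j ^ 2) * ?z * ((1 - y j) * (T j (8 * k + 4) + W j (8 * k + 6)))"
    by (simp only: algebra_simps)
  also have "\<dots> = T (Suc j) (8 * k + 3) + W (Suc j) (8 * k + 4) + W (Suc j) (8 * k + 5)"
    unfolding T_below_6[OF assms(1)] assms(2) W_Suc_eq by (simp only: algebra_simps)
  also have "\<dots> = T (Suc j) (8 * k + 5)"
    using T_step[of "8 * k + 4" "8 * k + 3"] T_step[of "8 * k + 5" "8 * k + 4"] by simp
  finally show ?thesis .
qed

text \<open>Here two summands of the recurrences have indices that are off by one in opposite directions.
  The resulting errors cancel because the words starting with \<open>8 k + 4\<close> and with \<open>8 k + 5\<close> have the same continuations: their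
  generating functions for \<open>j + 1\<close> differ by a factor \<open>y j\<close>.\<close>

lemma T_case_10:
  assumes "(1 - y j) * T j (8 * k + 6) = T (Suc j) (8 * k + 3)"
    and "(1 - y j) * T j (8 * k + 8) = T (Suc j) (8 * k + 5)"
  shows "(1 - y j) * T j (8 * k + 10) = T (Suc j) (8 * k + 7)"
proof -
  let ?z = "fps_X ^ (8 * k + 8) :: int fps"
  let ?e = "1 - y j ^ 2 * ?z"
  let ?g = "T (Suc j) (8 * k + 4) + W (Suc j) (8 * k + 6)"
  have "W j (8 * k + 9) = y j * ?z * T j (8 * k + 6)"
    and "W j (8 * k + 10) = y j ^ 2 * ?z * T j (8 * k + 10)"
    using W_eq(1,2)[of j "Suc k"] by (simp_all add: add.commute)
  then have t: "?e * T j (8 * k + 10) = T j (8 * k + 8) + y j * ?z * T j (8 * k + 6)"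
    using T_step[of "8 * k + 9" "8 * k + 8" j] T_step[of "8 * k + 10" "8 * k + 9" j]
    by (simp add: algebra_simps)
  have g: "?e * ?g = T (Suc j) (8 * k + 4)"
    using W_Suc_eq(6)[of j k] by (simp add: algebra_simps)
  have s5: "T (Suc j) (8 * k + 5) = T (Suc j) (8 * k + 4) + W (Suc j) (8 * k + 5)"
    and s4: "T (Suc j) (8 * k + 4) = T (Suc j) (8 * k + 3) + W (Suc j) (8 * k + 4)"
    using T_step[of "8 * k + 4" "8 * k + 3"] T_step[of "8 * k + 5" "8 * k + 4"] by simp_all
  have w: "y j * W (Suc j) (8 * k + 5) = W (Suc j) (8 * k + 4)"
    unfolding W_Suc_eq by (simp add: power2_eq_square)
  have "T (Suc j) (8 * k + 7) = T (Suc j) (8 * k + 5) + (y j + y j ^ 2) * ?z * ?g"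
    using T_step[of "8 * k + 6" "8 * k + 5" "Suc j"] T_step[of "8 * k + 7" "8 * k + 6" "Suc j"]
      W_Suc_eq(6,7)[of j k] by (simp add: algebra_simps)
  then have "?e * T (Suc j) (8 * k + 7) = ?e * T (Suc j) (8 * k + 5) + (y j + y j ^ 2) * ?z * (?e * ?g)"
    by (simp only: algebra_simps)
  also have "\<dots> = T (Suc j) (8 * k + 5) + y j * ?z * T (Suc j) (8 * k + 3)
      + y j * ?z * (W (Suc j) (8 * k + 4) - y j * W (Suc j) (8 * k + 5))"
    unfolding g unfolding s5 s4 by (simp add: algebra_simps power2_eq_square)
  also have "\<dots> = (1 - y j) * T j (8 * k + 8) + y j * ?z * ((1 - y j) * T j (8 * k + 6))"
    unfolding w assms by simp
  also have "\<dots> = (1 - y j) * (?e * T j (8 * k + 10))"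
    unfolding t by (simp only: algebra_simps)
  finally have "?e * ((1 - y j) * T j (8 * k + 10)) = ?e * T (Suc j) (8 * k + 7)"
    by (simp only: mult.left_commute)
  then show ?thesis
    using one_minus_y_square_nonzero[of j "8 * k + 8"] by (simp only: mult_cancel_left simp_thms)
qed

text \<open>The recurrence for \<open>j\<close> involves the odd index \<open>8 k + 7\<close>, to which the induction
  hypothesis does not apply; it is replaced by \<open>8 k + 8\<close>, at the cost of a correction for the
  words starting with \<open>8 k + 8\<close>. Lemma \<open>T_below_6\<close> turns this correction into the series of the
  words starting with \<open>8 k + 5\<close> for \<open>j + 1\<close>. The remaining error cancels because
  \<open>8 k + 6\<close> and \<open>8 k + 7\<close> have the same continuations.\<close>

lemma T_case_12:
  assumes "(1 - y j) * T j (8 * k + 4) = T (Suc j) (8 * k + 1)"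
    and "(1 - y j) * T j (8 * k + 8) = T (Suc j) (8 * k + 5)"
    and "(1 - y j) * T j (8 * k + 10) = T (Suc j) (8 * k + 7)"
  shows "(1 - y j) * T j (8 * k + 12) = T (Suc j) (8 * k + 9)"
proof -
  let ?z = "fps_X ^ (8 * k + 10) :: int fps"
  let ?g = "T (Suc j) (8 * k + 4) + W (Suc j) (8 * k + 6)"
  have "W j (8 * k + 11) = y j * ?z * T j (8 * k + 7)"
    and "W j (8 * k + 12) = y j ^ 2 * ?z * T j (8 * k + 10)"
    using W_eq(3,4)[of j "Suc k"] by (simp_all add: add.commute)
  then have t12: "T j (8 * k + 12) = T j (8 * k + 10) + y j ^ 2 * ?z * T j (8 * k + 10)
      + y j * ?z * (T j (8 * k + 8) - W j (8 * k + 8))"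
    using T_step[of "8 * k + 11" "8 * k + 10" j] T_step[of "8 * k + 12" "8 * k + 11" j]
      T_step[of "8 * k + 8" "8 * k + 7" j]
    by (simp add: algebra_simps)
  have "(1 - y j) * T j (8 * k + 12) = (1 - y j) * T j (8 * k + 10)
      + y j ^ 2 * ?z * ((1 - y j) * T j (8 * k + 10))
      + y j * ?z * ((1 - y j) * T j (8 * k + 8) - (1 - y j) * W j (8 * k + 8))"
    unfolding t12 by (simp only: algebra_simps)
  also have "(1 - y j) * W j (8 * k + 8) = y j * W (Suc j) (8 * k + 5)"
  proof -
    have "(1 - y j) * W j (8 * k + 8)
        = y j ^ 2 * fps_X ^ (8 * k + 6) * ((1 - y j) * (T j (8 * k + 4) + W j (8 * k + 6)))"
      by (subst W_eq(8)) (simp only: mult.left_commute)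
    then show ?thesis
      unfolding T_below_6[OF assms(1)] W_Suc_eq by (simp add: power2_eq_square mult.assoc)
  qed
  also have "(1 - y j) * T j (8 * k + 10) + y j ^ 2 * ?z * ((1 - y j) * T j (8 * k + 10))
      + y j * ?z * ((1 - y j) * T j (8 * k + 8) - y j * W (Suc j) (8 * k + 5))
    = T (Suc j) (8 * k + 7) + y j ^ 2 * ?z * ?g + y j * ?z * T (Suc j) (8 * k + 6)"
  proof -
    have w: "W (Suc j) (8 * k + 6) = y j * W (Suc j) (8 * k + 7)"
      by (subst W_Suc_eq(6)) (simp add: W_Suc_eq(7) power2_eq_square mult.assoc)
    have "y j ^ 2 * ?z * W (Suc j) (8 * k + 7) = y j * ?z * W (Suc j) (8 * k + 6)"
      unfolding w by (simp only: power2_eq_square ac_simps)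
    then show ?thesis
      using T_step[of "8 * k + 5" "8 * k + 4" "Suc j"] T_step[of "8 * k + 6" "8 * k + 5" "Suc j"]
        T_step[of "8 * k + 7" "8 * k + 6" "Suc j"]
      unfolding assms by (simp add: algebra_simps power2_eq_square)
  qed
  also have "\<dots> = T (Suc j) (8 * k + 7) + W (Suc j) (8 * k + 8) + W (Suc j) (8 * k + 9)"
    using W_Suc_eq(8)[of j k] W_Suc_eq(1)[of j "Suc k"] by (simp add: add.commute)
  also have "\<dots> = T (Suc j) (8 * k + 9)"
    using T_step[of "8 * k + 8" "8 * k + 7" "Suc j"] T_step[of "8 * k + 9" "8 * k + 8" "Suc j"] by simp
  finally show ?thesis .
qed

lemma T_case_2: "(1 - y j) * T j 2 = 1"
proof -
  have "T j 2 = 1 + y j + y j ^ 2 * T j 2"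
    using T_step[of 1 0 j] T_step[of 2 1 j] W_eq(1,2)[of j 0]
    by (simp add: T_0 del: add_2_eq_Suc')
  then have "(1 - y j ^ 2) * T j 2 = 1 + y j"
    by (simp add: algebra_simps)
  then have "(1 + y j) * ((1 - y j) * T j 2) = (1 + y j) * 1"
    by (simp add: algebra_simps power2_eq_square)
  moreover have "1 + y j \<noteq> 0"
    using one_minus_y_square_nonzero[of j 0] by (auto simp: power2_eq_square add_eq_0_iff)
  ultimately show ?thesis by (simp only: mult_cancel_left simp_thms)
qed

lemma T_case_4: "(1 - y j) * T j 4 = T (Suc j) 1"
proof -
  have "T j 4 = T j 2 + y j * fps_X ^ 2 + y j ^ 2 * fps_X ^ 2 * T j 2"
    using T_step[of 3 2 j] T_step[of 4 3 j] W_eq(3,4)[of j 0]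
    by (simp add: T_0 del: add_2_eq_Suc')
  then have "(1 - y j) * T j 4 = (1 + y j ^ 2 * fps_X ^ 2) * ((1 - y j) * T j 2) + (1 - y j) * y j * fps_X ^ 2"
    by (simp only: algebra_simps mult_1_left)
  also have "\<dots> = 1 + y j * fps_X ^ 2"
    unfolding T_case_2 by (simp add: algebra_simps power2_eq_square)
  also have "\<dots> = T (Suc j) 1"
    using T_step[of 1 0 "Suc j"] W_Suc_eq(1)[of j 0] by (simp add: T_0 del: add_2_eq_Suc')
  finally show ?thesis .
qed

lemma T_functional_equation:
  "(1 - y j) * T j (8 * k + 2) = T (Suc j) (8 * k - 1) \<and>
   (1 - y j) * T j (8 * k + 4) = T (Suc j) (8 * k + 1) \<and>
   (1 - y j) * T j (8 * k + 6) = T (Suc j) (8 * k + 3) \<and>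
   (1 - y j) * T j (8 * k + 8) = T (Suc j) (8 * k + 5)"
proof (induction k)
  case 0
  have "(1 - y j) * T j 6 = T (Suc j) 3"
    using T_case_6[of j 0] T_case_2 T_case_4 by (simp add: T_0 del: add_2_eq_Suc')
  moreover from this have "(1 - y j) * T j 8 = T (Suc j) 5"
    using T_case_8[of j 0] T_case_4 by simp
  ultimately show ?case
    using T_case_2 T_case_4 by (simp add: T_0 del: add_2_eq_Suc')
next
  case (Suc k)
  have 10: "(1 - y j) * T j (8 * k + 10) = T (Suc j) (8 * k + 7)"
    using T_case_10 Suc.IH by blast
  have 12: "(1 - y j) * T j (8 * k + 12) = T (Suc j) (8 * k + 9)"
    using T_case_12 Suc.IH 10 by blast
  have 14: "(1 - y j) * T j (8 * k + 14) = T (Suc j) (8 * k + 11)"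
    using T_case_6[of j "Suc k"] 10 12 by (simp add: add.commute del: add_2_eq_Suc add_2_eq_Suc')
  have 16: "(1 - y j) * T j (8 * k + 16) = T (Suc j) (8 * k + 13)"
    using T_case_8[of j "Suc k"] 12 14 by (simp add: add.commute del: add_2_eq_Suc add_2_eq_Suc')
  show ?case
    using 10 12 14 16 by (simp add: add.commute del: add_2_eq_Suc add_2_eq_Suc')
qed

section \<open>Comparison of coefficients\<close>

lemma fps_nth_T:
  assumes "N \<le> n"
  shows "fps_nth (T j n) N = int (card (words j UNIV N))"
proof -
  have "hd ps \<in> {0<..n}" if "admissible ps" "ps \<noteq> []" "weight j ps = N" for ps
  proof -
    obtain a qs where ps: "ps = a # qs" using \<open>ps \<noteq> []\<close> by (cases ps) auto
    then have "a \<le> sum_list ps" by simp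
    then show ?thesis
      using that ps sum_list_le_weight[of ps j] assms by (auto simp: admissible_Cons)
  qed
  then have "words j {0<..n} N = words j UNIV N"
    by (auto simp: words_def)
  then show ?thesis by (simp add: T_def gf_def)
qed

lemma card_words_rec:
  "card (words j UNIV N) =
     (if 2 * j + 1 \<le> N then card (words j UNIV (N - (2 * j + 1))) else 0) + card (words (Suc j) UNIV N)"
proof -
  (* any even bound n with n - 3 \<ge> N does: the coefficients up to N then see all words *)
  let ?n = "8 * N + 8"
  have "T j ?n = y j * T j ?n + T (Suc j) (8 * N + 5)"
    using T_functional_equation[of j N] by (simp add: algebra_simps)
  then have "fps_nth (T j ?n) N = fps_nth (y j * T j ?n) N + fps_nth (T (Suc j) (8 * N + 5)) N"
    by (metis fps_add_nth)
  also have "fps_nth (y j * T j ?n) N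
      = (if 2 * j + 1 \<le> N then fps_nth (T j ?n) (N - (2 * j + 1)) else 0)"
    unfolding y_def fps_X_power_mult_nth by auto
  finally show ?thesis
    by (simp add: fps_nth_T split: if_splits)
qed

section \<open>Partitions into odd parts\<close>

definition odd_words :: "nat \<Rightarrow> nat \<Rightarrow> nat list set" where
  "odd_words j N = {ps. sorted_wrt (\<ge>) ps \<and> (\<forall>p\<in>set ps. odd p \<and> 2 * j + 1 \<le> p) \<and> sum_list ps = N}"

lemma odd_words_0: "odd_words 0 N = odd_partitions N"
proof -
  have "odd p \<Longrightarrow> Suc 0 \<le> p" for p :: nat
    by (simp add: Suc_leI odd_pos)
  then show ?thesis
    by (auto simp: odd_words_def odd_partitions_def partitions_def)
qed

lemma finite_odd_words: "finite (odd_words j N)"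
  by (rule finite_subset[OF _ finite_partitions[of N]]) (auto simp: odd_words_def partitions_def)

text \<open>If the smallest part is \<open>2 j + 1\<close>, remove one copy of it; otherwise all parts are at least
  \<open>2 j + 3\<close>.\<close>

lemma card_odd_words_rec:
  "card (odd_words j N) =
     (if 2 * j + 1 \<le> N then card (odd_words j (N - (2 * j + 1))) else 0) + card (odd_words (Suc j) N)"
proof -
  let ?m = "2 * j + 1"
  let ?S = "if ?m \<le> N then odd_words j (N - ?m) else {}"
  have "odd_words j N = (\<lambda>ps. ps @ [?m]) ` ?S \<union> odd_words (Suc j) N" (is "?L = ?R")
  proof (intro equalityI subsetI)
    fix ps assume ps: "ps \<in> ?L"
    show "ps \<in> ?R"
    proof (cases "ps \<noteq> [] \<and> last ps = ?m")
      case True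
      then obtain qs where "ps = qs @ [?m]"
        by (metis append_butlast_last_id)
      then show ?thesis
        using ps by (auto simp: odd_words_def sorted_wrt_append)
    next
      case False
      have "2 * Suc j + 1 \<le> p" if "p \<in> set ps" for p
      proof -
        have "ps \<noteq> []" using that by auto
        then obtain qs b where qs: "ps = qs @ [b]"
          by (metis append_butlast_last_id)
        have "b \<noteq> ?m" "odd b" "?m \<le> b" "b \<le> p" "odd p"
          using False qs ps that by (auto simp: odd_words_def sorted_wrt_append)
        then show ?thesis by presburger
      qed
      then show ?thesis using ps by (auto simp: odd_words_def)
    qed
  next
    fix ps assume "ps \<in> ?R"
    then show "ps \<in> ?L"
      by (fastforce simp: odd_words_def sorted_wrt_append split: if_splits)
  qed
  moreover have "(\<lambda>ps. ps @ [?m]) ` ?S \<inter> odd_words (Suc j) N = {}"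
  proof -
    have "?m \<notin> set ps" if "ps \<in> odd_words (Suc j) N" for ps
      using that by (auto simp: odd_words_def)
    moreover have "?m \<in> set ps" if "ps \<in> (\<lambda>ps. ps @ [?m]) ` X" for ps X
      using that by auto
    ultimately show ?thesis by blast
  qed
  moreover have "card ((\<lambda>ps. ps @ [?m]) ` ?S) = card ?S"
    by (intro card_image inj_onI) simp
  ultimately show ?thesis
    by (simp add: card_Un_disjoint finite_odd_words)
qed

section \<open>The two counts agree\<close>

lemma card_words_large:
  assumes "N \<le> j"
  shows "card (words j UNIV N) = (if N = 0 then 1 else 0)"
proof -
  have "j < weight j ps" if "admissible ps" "ps \<noteq> []" for ps
    using that by (cases ps) (auto simp: admissible_Cons wt_def)
  then have "words j UNIV N \<subseteq> {[]}"
    using assms by (fastforce simp: words_def)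
  moreover have "[] \<in> words j UNIV N \<longleftrightarrow> N = 0"
    by (auto simp: words_def)
  ultimately have "words j UNIV N = (if N = 0 then {[]} else {})"
    by auto
  then show ?thesis by simp
qed

lemma card_odd_words_large:
  assumes "N \<le> j"
  shows "card (odd_words j N) = (if N = 0 then 1 else 0)"
proof -
  have "j < sum_list ps" if "\<forall>p\<in>set ps. 2 * j + 1 \<le> p" "ps \<noteq> []" for ps
    using that by (cases ps) auto
  then have "odd_words j N \<subseteq> {[]}"
    using assms by (fastforce simp: odd_words_def)
  moreover have "[] \<in> odd_words j N \<longleftrightarrow> N = 0"
    by (auto simp: odd_words_def)
  ultimately have "odd_words j N = (if N = 0 then {[]} else {})"
    by auto
  then show ?thesis by simp
qed

text \<open>The common recurrence either lowers \<open>N\<close> or raises \<open>j\<close>, so it ends in the range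
  \<open>N \<le> j\<close>, where only the empty word can have weight \<open>N\<close>. Before that,
  \<open>2 N - j\<close> decreases in both cases.\<close>

lemma card_odd_words_eq_card_words: "card (odd_words j N) = card (words j UNIV N)"
proof (induction "2 * N - j" arbitrary: j N rule: less_induct)
  case less
  show ?case
  proof (cases "N \<le> j")
    case True
    then show ?thesis by (simp only: card_words_large card_odd_words_large)
  next
    case False
    then have "card (odd_words (Suc j) N) = card (words (Suc j) UNIV N)"
      by (intro less) simp
    moreover have "card (odd_words j (N - (2 * j + 1))) = card (words j UNIV (N - (2 * j + 1)))"
      using False by (intro less) simp
    ultimately show ?thesis
      by (simp only: card_odd_words_rec[of j N] card_words_rec[of j N])
  qed
qed

theorem theorem1p11:
  fixes n :: nat
  assumes "n > 0"
  shows "card (odd_partitions n) = card (diff_partitions n)"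
proof -
  have "diff_partitions n = words 0 UNIV n"
    by (simp add: diff_partitions_eq_admissible words_def weight_0)
  then show ?thesis
    by (simp add: card_odd_words_eq_card_words flip: odd_words_0)
qed

end
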